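(* Let $\sigma\in\{\mathit{cf},\mathit{adm},\mathit{com},\mathit{prf},\mathit{grd},\mathit{stb}\}$, let $F=(A,R)$ be a SETAF and let $D=D_F$ be the SETADF associated to $F$. Then the set $\sigma_{\mathcal L}(F)$ of $\sigma$-labellings of $F$ and the set $\sigma(D)$ of $\sigma$-interpretations of $D$ are in one-to-one correspondence, with each labelling $\lambda\in\sigma_{\mathcal L}(F)$ corresponding to an interpretation $v\in\sigma(D)$ such that, for all $s\in A$, $v(s)=\mathbf t$ iff $\lambda(s)=\mathrm{in}$, $v(s)=\mathbf f$ iff $\lambda(s)=\mathrm{out}$, and $v(s)=\mathbf u$ iff $\lambda(s)=\mathrm{undec}$.
   Context: **SETAFs.** A SETAF is a pair $F=(A,R)$ with $A$ a finite set (of arguments) and $R\subseteq(2^A\setminus\{\emptyset\})\times A$. A labelling of $F$ is a total function $\lambda:A\to\{\mathrm{in},\mathrm{out},\mathrm{undec}\}$; $\lambda_x=\{a\in A\mid\lambda(a)=x\}$. A labelling $\lambda$ is conflict-free ($\mathit{cf}$) in $F$ if (i) for all $(B,a)\in R$, either $\lambda(a)\neq\mathrm{in}$ or there is $b\in B$ with $\lambda(b)\ne\mathrm{in}$; and (ii) for all $a\in A$, if $\lambda(a)=\mathrm{out}$ then there is $(B,a)\in R$ with $\lambda(b)=\mathrm{in}$ for all $b\in B$. A conflict-free labelling $\lambda$ is: - admissible ($\mathit{adm}$) iff for all $a$ with $\lambda(a)=\mathrm{in}$ and all $(B,a)\in R$ there is $b\in B$ with $\lambda(b)=\mathrm{out}$;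 - complete ($\mathit{com}$) iff for all $a\in A$: $\lambda(a)=\mathrm{in}$ iff for all $(B,a)\in R$ there is $b\in B$ with $\lambda(b)=\mathrm{out}$; and $\lambda(a)=\mathrm{out}$ iff there is $(B,a)\in R$ with $\lambda(b)=\mathrm{in}$ for all $b\in B$; - grounded ($\mathit{grd}$) iff it is complete and there is no complete $\lambda'$ with $\lambda'_{\mathrm{in}}\subsetneq\lambda_{\mathrm{in}}$; - preferred ($\mathit{prf}$) iff it is complete and there is no complete $\lambda'$ with $\lambda'_{\mathrm{in}}\supsetneq\lambda_{\mathrm{in}}$; - stable ($\mathit{stb}$) iff $\lambda_{\mathrm{undec}}=\emptyset$. $\sigma_{\mathcal L}(F)$ is the set of all $\sigma$-labellings of $F$. **ADFs.** An ADF is $D=(S,L,C)$ with $S$ a finite set of arguments, $L\subseteq S\times S$ a set of links, and $C=\{\varphi_s\}_{s\in S}$ propositional formulas (acceptance conditions), where the atoms occurring in $\varphi_s$ are exactly $\mathrm{par}(s)=\{b\mid(b,s)\in L\}$. An interpretation is $v:S\to\{\mathbf t,\mathbf f,\mathbf u\}$; it is two-valued if it never takes the value $\mathbf u$; $v^{\mathbf t}=\{s\mid v(s)=\mathbf t\}$. The information order $\le_i$ on truth values is the reflexive closure of $\mathbf u<_i\mathbf t$, $\mathbf u<_i\mathbf f$, extended pointwise to interpretations. The partial valuation is $\varphi_s^v=v(\varphi_s)=\varphi_s[p/\top:v(p)=\mathbf t][p/\bot:v(p)=\mathbf f]$. The operator $\Gamma_D$ is: $\Gamma_D(v)(s)=\mathbf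 t$ if $\varphi_s^v$ is a tautology, $\mathbf f$ if $\varphi_s^v$ is unsatisfiable, $\mathbf u$ otherwise. An interpretation $v$ of $D$ is: - conflict-free ($\mathit{cf}$) iff $v(s)=\mathbf t$ implies $\varphi_s^v$ satisfiable and $v(s)=\mathbf f$ implies $\varphi_s^v$ unsatisfiable; - admissible ($\mathit{adm}$) iff $v\le_i\Gamma_D(v)$; complete ($\mathit{com}$) iff $v=\Gamma_D(v)$; grounded ($\mathit{grd}$) iff $v$ is the $\le_i$-least fixed point of $\Gamma_D$; preferred ($\mathit{prf}$) iff $v$ is $\le_i$-maximal admissible; - a model iff $v$ is two-valued and $v(s)=v(\varphi_s)$ for all $s\in S$; - a stable model ($\mathit{stb}$) iff $v$ is a model and $v^{\mathbf t}=w^{\mathbf t}$, where $w$ is the grounded interpretation of the reduct $D^v=(S^v,L^v,C^v)$ with $S^v=v^{\mathbf t}$, $L^v=L\cap(S^v\times S^v)$ and acceptance conditions $\varphi_s[p/\bot:v(p)=\mathbf f]$ for $s\in S^v$. $\sigma(D)$ is the set of all $\sigma$-interpretations of $D$. **Associated SETADF.** For a SETAF $F=(A,R)$, $D_F=(S,L,C)$ has $S=A$, $L=\{(a,b)\mid(B,b)\in R,\ a\in B\}$ and $\varphi_a=\bigwedge_{(B,a)\in R}\bigvee_{a'\in B}\neg a'$ for each $a\in S$ (the empty conjunction is $\top$). *)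

theory Defs
  imports "HOL-Library.FuncSet"
begin

record 'a setaf =
  arguments :: "'a set"
  attacks :: "('a set \<times> 'a) set"

definition is_setaf :: "'a setaf \<Rightarrow> bool" where
  "is_setaf F \<longleftrightarrow>
     finite (arguments F) \<and>
     attacks F \<subseteq> (Pow (arguments F) - {{}}) \<times> arguments F"

datatype label = In | Out | Undec

text \<open>A total function on the set of arguments is represented by an extensional function
  (constantly \<open>undefined\<close> outside that set), so that there is exactly one HOL function for
  each labelling. Interpretations of ADFs are treated in the same way.\<close>

definition labellings :: "'a setaf \<Rightarrow> ('a \<Rightarrow> label) set" where
  "labellings F = arguments F \<rightarrow>\<^sub>E UNIV"

definition label_set :: "'a setaf \<Rightarrow> ('a \<Rightarrow> label) \<Rightarrow> label \<Rightarrow> 'a set" where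
  "label_set F l x = {a \<in> arguments F. l a = x}"

definition lab_cf :: "'a setaf \<Rightarrow> ('a \<Rightarrow> label) \<Rightarrow> bool" where
  "lab_cf F l \<longleftrightarrow> l \<in> labellings F \<and>
     (\<forall>(B, a) \<in> attacks F. l a \<noteq> In \<or> (\<exists>b\<in>B. l b \<noteq> In)) \<and>
     (\<forall>a \<in> arguments F. l a = Out \<longrightarrow> (\<exists>B. (B, a) \<in> attacks F \<and> (\<forall>b\<in>B. l b = In)))"

definition lab_adm :: "'a setaf \<Rightarrow> ('a \<Rightarrow> label) \<Rightarrow> bool" where
  "lab_adm F l \<longleftrightarrow> lab_cf F l \<and>
     (\<forall>a \<in> arguments F. l a = In \<longrightarrow>
        (\<forall>B. (B, a) \<in> attacks F \<longrightarrow> (\<exists>b\<in>B. l b = Out)))"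

definition lab_com :: "'a setaf \<Rightarrow> ('a \<Rightarrow> label) \<Rightarrow> bool" where
  "lab_com F l \<longleftrightarrow> lab_cf F l \<and>
     (\<forall>a \<in> arguments F.
        (l a = In \<longleftrightarrow> (\<forall>B. (B, a) \<in> attacks F \<longrightarrow> (\<exists>b\<in>B. l b = Out))) \<and>
        (l a = Out \<longleftrightarrow> (\<exists>B. (B, a) \<in> attacks F \<and> (\<forall>b\<in>B. l b = In))))"

definition lab_grd :: "'a setaf \<Rightarrow> ('a \<Rightarrow> label) \<Rightarrow> bool" where
  "lab_grd F l \<longleftrightarrow> lab_com F l \<and>
     \<not> (\<exists>l'. lab_com F l' \<and> label_set F l' In \<subset> label_set F l In)"

definition lab_prf :: "'a setaf \<Rightarrow> ('a \<Rightarrow> label) \<Rightarrow> bool" where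
  "lab_prf F l \<longleftrightarrow> lab_com F l \<and>
     \<not> (\<exists>l'. lab_com F l' \<and> label_set F l In \<subset> label_set F l' In)"

definition lab_stb :: "'a setaf \<Rightarrow> ('a \<Rightarrow> label) \<Rightarrow> bool" where
  "lab_stb F l \<longleftrightarrow> lab_cf F l \<and> label_set F l Undec = {}"

datatype semantics = CF | ADM | COM | PRF | GRD | STB

fun setaf_labellings :: "semantics \<Rightarrow> 'a setaf \<Rightarrow> ('a \<Rightarrow> label) set" where
  "setaf_labellings CF F = {l. lab_cf F l}"
| "setaf_labellings ADM F = {l. lab_adm F l}"
| "setaf_labellings COM F = {l. lab_com F l}"
| "setaf_labellings PRF F = {l. lab_prf F l}"
| "setaf_labellings GRD F = {l. lab_grd F l}"
| "setaf_labellings STB F = {l. lab_stb F l}"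


datatype (atoms: 'a) form =
    Top
  | Bot
  | Atom 'a
  | Neg "'a form"
  | And "'a form" "'a form"
  | Or "'a form" "'a form"

primrec eval :: "('a \<Rightarrow> bool) \<Rightarrow> 'a form \<Rightarrow> bool" where
  "eval I Top \<longleftrightarrow> True"
| "eval I Bot \<longleftrightarrow> False"
| "eval I (Atom p) \<longleftrightarrow> I p"
| "eval I (Neg \<phi>) \<longleftrightarrow> \<not> eval I \<phi>"
| "eval I (And \<phi> \<psi>) \<longleftrightarrow> eval I \<phi> \<and> eval I \<psi>"
| "eval I (Or \<phi> \<psi>) \<longleftrightarrow> eval I \<phi> \<or> eval I \<psi>"

primrec subst :: "('a \<Rightarrow> 'a form) \<Rightarrow> 'a form \<Rightarrow> 'a form" where
  "subst f Top = Top"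
| "subst f Bot = Bot"
| "subst f (Atom p) = f p"
| "subst f (Neg \<phi>) = Neg (subst f \<phi>)"
| "subst f (And \<phi> \<psi>) = And (subst f \<phi>) (subst f \<psi>)"
| "subst f (Or \<phi> \<psi>) = Or (subst f \<phi>) (subst f \<psi>)"

definition tautology :: "'a form \<Rightarrow> bool" where
  "tautology \<phi> \<longleftrightarrow> (\<forall>I. eval I \<phi>)"

definition satisfiable :: "'a form \<Rightarrow> bool" where
  "satisfiable \<phi> \<longleftrightarrow> (\<exists>I. eval I \<phi>)"

abbreviation unsatisfiable :: "'a form \<Rightarrow> bool" where
  "unsatisfiable \<phi> \<equiv> \<not> satisfiable \<phi>"

text \<open>A conjunction or disjunction indexed by a finite set is only determined up to the order
  of its members. An arbitrary enumeration of the index set is chosen; the two lemmas on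
  \<open>eval\<close> below show that the choice does not matter.\<close>

definition enumeration :: "'b set \<Rightarrow> 'b list" where
  "enumeration X = (SOME xs. distinct xs \<and> set xs = X)"

definition Conj :: "'b set \<Rightarrow> ('b \<Rightarrow> 'a form) \<Rightarrow> 'a form" where
  "Conj X f = foldr (\<lambda>x. And (f x)) (enumeration X) Top"

definition Disj :: "'b set \<Rightarrow> ('b \<Rightarrow> 'a form) \<Rightarrow> 'a form" where
  "Disj X f = foldr (\<lambda>x. Or (f x)) (enumeration X) Bot"

lemma set_enumeration [simp]: "finite X \<Longrightarrow> set (enumeration X) = X"
  unfolding enumeration_def
  using someI_ex[of "\<lambda>xs. distinct xs \<and> set xs = X"] finite_distinct_list[of X] by blast

lemma eval_Conj: "finite X \<Longrightarrow> eval I (Conj X f) \<longleftrightarrow> (\<forall>x\<in>X. eval I (f x))"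
proof -
  have "eval I (foldr (\<lambda>x. And (f x)) xs Top) \<longleftrightarrow> (\<forall>x\<in>set xs. eval I (f x))" for xs
    by (induction xs) auto
  then show "finite X \<Longrightarrow> ?thesis" by (simp add: Conj_def)
qed

lemma eval_Disj: "finite X \<Longrightarrow> eval I (Disj X f) \<longleftrightarrow> (\<exists>x\<in>X. eval I (f x))"
proof -
  have "eval I (foldr (\<lambda>x. Or (f x)) xs Bot) \<longleftrightarrow> (\<exists>x\<in>set xs. eval I (f x))" for xs
    by (induction xs) auto
  then show "finite X \<Longrightarrow> ?thesis" by (simp add: Disj_def)
qed

lemma atoms_Conj: "finite X \<Longrightarrow> atoms (Conj X f) = (\<Union>x\<in>X. atoms (f x))"
proof -
  have "atoms (foldr (\<lambda>x. And (f x)) xs Top) = (\<Union>x\<in>set xs. atoms (f x))" for xs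
    by (induction xs) auto
  then show "finite X \<Longrightarrow> ?thesis" by (simp add: Conj_def)
qed

lemma atoms_Disj: "finite X \<Longrightarrow> atoms (Disj X f) = (\<Union>x\<in>X. atoms (f x))"
proof -
  have "atoms (foldr (\<lambda>x. Or (f x)) xs Bot) = (\<Union>x\<in>set xs. atoms (f x))" for xs
    by (induction xs) auto
  then show "finite X \<Longrightarrow> ?thesis" by (simp add: Disj_def)
qed

lemma atoms_subst: "atoms (subst f \<phi>) = (\<Union>p\<in>atoms \<phi>. atoms (f p))"
  by (induction \<phi>) auto


record 'a adf =
  statements :: "'a set"
  links :: "('a \<times> 'a) set"
  acc :: "'a \<Rightarrow> 'a form"

definition par :: "'a adf \<Rightarrow> 'a \<Rightarrow> 'a set" where
  "par D s = {b. (b, s) \<in> links D}"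

definition is_adf :: "'a adf \<Rightarrow> bool" where
  "is_adf D \<longleftrightarrow>
     finite (statements D) \<and>
     links D \<subseteq> statements D \<times> statements D \<and>
     (\<forall>s \<in> statements D. atoms (acc D s) = par D s)"

datatype tv = TT | FF | UU

definition interpretations :: "'a adf \<Rightarrow> ('a \<Rightarrow> tv) set" where
  "interpretations D = statements D \<rightarrow>\<^sub>E UNIV"

definition two_valued :: "'a adf \<Rightarrow> ('a \<Rightarrow> tv) \<Rightarrow> bool" where
  "two_valued D v \<longleftrightarrow> (\<forall>s \<in> statements D. v s \<noteq> UU)"

definition true_set :: "'a adf \<Rightarrow> ('a \<Rightarrow> tv) \<Rightarrow> 'a set" where
  "true_set D v = {s \<in> statements D. v s = TT}"

definition tv_le :: "tv \<Rightarrow> tv \<Rightarrow> bool" where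
  "tv_le x y \<longleftrightarrow> x = y \<or> (x = UU \<and> y = TT) \<or> (x = UU \<and> y = FF)"

definition info_le :: "'a adf \<Rightarrow> ('a \<Rightarrow> tv) \<Rightarrow> ('a \<Rightarrow> tv) \<Rightarrow> bool" where
  "info_le D v w \<longleftrightarrow> (\<forall>s \<in> statements D. tv_le (v s) (w s))"

definition pval :: "('a \<Rightarrow> tv) \<Rightarrow> 'a form \<Rightarrow> 'a form" where
  "pval v = subst (\<lambda>p. case v p of TT \<Rightarrow> Top | FF \<Rightarrow> Bot | UU \<Rightarrow> Atom p)"

definition Gamma :: "'a adf \<Rightarrow> ('a \<Rightarrow> tv) \<Rightarrow> ('a \<Rightarrow> tv)" where
  "Gamma D v = (\<lambda>s \<in> statements D.
     if tautology (pval v (acc D s)) then TT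
     else if unsatisfiable (pval v (acc D s)) then FF
     else UU)"

definition int_cf :: "'a adf \<Rightarrow> ('a \<Rightarrow> tv) \<Rightarrow> bool" where
  "int_cf D v \<longleftrightarrow> v \<in> interpretations D \<and>
     (\<forall>s \<in> statements D.
        (v s = TT \<longrightarrow> satisfiable (pval v (acc D s))) \<and>
        (v s = FF \<longrightarrow> unsatisfiable (pval v (acc D s))))"

definition int_adm :: "'a adf \<Rightarrow> ('a \<Rightarrow> tv) \<Rightarrow> bool" where
  "int_adm D v \<longleftrightarrow> v \<in> interpretations D \<and> info_le D v (Gamma D v)"

definition int_com :: "'a adf \<Rightarrow> ('a \<Rightarrow> tv) \<Rightarrow> bool" where
  "int_com D v \<longleftrightarrow> v \<in> interpretations D \<and> v = Gamma D v"

definition int_grd :: "'a adf \<Rightarrow> ('a \<Rightarrow> tv) \<Rightarrow> bool" where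
  "int_grd D v \<longleftrightarrow> v \<in> interpretations D \<and> v = Gamma D v \<and>
     (\<forall>w \<in> interpretations D. w = Gamma D w \<longrightarrow> info_le D v w)"

definition int_prf :: "'a adf \<Rightarrow> ('a \<Rightarrow> tv) \<Rightarrow> bool" where
  "int_prf D v \<longleftrightarrow> int_adm D v \<and> \<not> (\<exists>w. int_adm D w \<and> info_le D v w \<and> w \<noteq> v)"

text \<open>For two-valued \<open>v\<close> the formula \<open>pval v (acc D s)\<close> of an ADF contains no atoms, so its
  truth value does not depend on the assignment \<open>I\<close>.\<close>

definition is_model :: "'a adf \<Rightarrow> ('a \<Rightarrow> tv) \<Rightarrow> bool" where
  "is_model D v \<longleftrightarrow> v \<in> interpretations D \<and> two_valued D v \<and>
     (\<forall>s \<in> statements D. \<forall>I. v s = (if eval I (pval v (acc D s)) then TT else FF))"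

definition reduct :: "'a adf \<Rightarrow> ('a \<Rightarrow> tv) \<Rightarrow> 'a adf" where
  "reduct D v =
     \<lparr> statements = true_set D v,
       links = links D \<inter> (true_set D v \<times> true_set D v),
       acc = (\<lambda>s. subst (\<lambda>p. if v p = FF then Bot else Atom p) (acc D s)) \<rparr>"

definition int_stb :: "'a adf \<Rightarrow> ('a \<Rightarrow> tv) \<Rightarrow> bool" where
  "int_stb D v \<longleftrightarrow> is_model D v \<and>
     (\<exists>w. int_grd (reduct D v) w \<and> true_set D v = true_set (reduct D v) w)"

fun adf_interpretations :: "semantics \<Rightarrow> 'a adf \<Rightarrow> ('a \<Rightarrow> tv) set" where
  "adf_interpretations CF D = {v. int_cf D v}"
| "adf_interpretations ADM D = {v. int_adm D v}"
| "adf_interpretations COM D = {v. int_com D v}"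
| "adf_interpretations PRF D = {v. int_prf D v}"
| "adf_interpretations GRD D = {v. int_grd D v}"
| "adf_interpretations STB D = {v. int_stb D v}"

lemma int_grd_unique:
  assumes "int_grd D v" "int_grd D w"
  shows "v = w"
proof -
  have "v s = w s" if "s \<in> statements D" for s
    using assms that by (fastforce simp: int_grd_def info_le_def tv_le_def)
  then show ?thesis
    using assms by (auto simp: int_grd_def interpretations_def intro: PiE_ext)
qed

lemma is_adf_reduct:
  assumes "is_adf D" "two_valued D v"
  shows "is_adf (reduct D v)"
  unfolding is_adf_def
proof (intro conjI ballI)
  show "finite (statements (reduct D v))"
    using assms(1) by (simp add: is_adf_def reduct_def true_set_def)
  show "links (reduct D v) \<subseteq> statements (reduct D v) \<times> statements (reduct D v)"
    by (simp add: reduct_def)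
  fix s assume "s \<in> statements (reduct D v)"
  then have s: "s \<in> statements D" "s \<in> true_set D v"
    by (simp_all add: reduct_def true_set_def)
  have par: "par D s \<subseteq> statements D"
    using assms(1) by (auto simp: is_adf_def par_def)
  have "atoms (acc (reduct D v) s) = (\<Union>p\<in>atoms (acc D s). if v p = FF then {} else {p})"
    unfolding reduct_def by (simp add: atoms_subst if_distrib cong: if_cong)
  also have "\<dots> = {p \<in> par D s. v p \<noteq> FF}"
    using assms(1) s(1) by (auto simp: is_adf_def)
  also have "\<dots> = par D s \<inter> true_set D v"
  proof -
    have "v p = TT \<longleftrightarrow> v p \<noteq> FF" if "p \<in> par D s" for p
      using assms(2) par that by (cases "v p") (auto simp: two_valued_def)
    then show ?thesis
      using par unfolding true_set_def by blast
  qed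
  also have "\<dots> = par (reduct D v) s"
    using s(2) unfolding par_def reduct_def by simp blast
  finally show "atoms (acc (reduct D v) s) = par (reduct D v) s" .
qed

definition setadf_of :: "'a setaf \<Rightarrow> 'a adf" where
  "setadf_of F =
     \<lparr> statements = arguments F,
       links = {(a, b). \<exists>B. (B, b) \<in> attacks F \<and> a \<in> B},
       acc = (\<lambda>a. Conj {B. (B, a) \<in> attacks F} (\<lambda>B. Disj B (\<lambda>b. Neg (Atom b)))) \<rparr>"

lemma is_adf_setadf_of:
  assumes "is_setaf F"
  shows "is_adf (setadf_of F)"
proof -
  have fin: "finite (arguments F)"
    and sub: "attacks F \<subseteq> Pow (arguments F) \<times> arguments F"
    using assms by (auto simp: is_setaf_def)
  have finB: "finite B" if "(B, a) \<in> attacks F" for B a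
    using that sub fin by (auto intro: finite_subset)
  have "finite {B. (B, a) \<in> attacks F}" for a
    by (rule finite_subset[of _ "Pow (arguments F)"]) (use sub fin in auto)
  then have "atoms (acc (setadf_of F) a) = par (setadf_of F) a" for a
    by (auto simp: setadf_of_def par_def atoms_Conj atoms_Disj finB)
  then show ?thesis
    using fin sub by (auto simp: is_adf_def setadf_of_def)
qed

end

theory Submission
  imports Defs
begin

text \<open>Relabelling \<open>In, Out, Undec\<close> as \<open>TT, FF, UU\<close> is a bijection. The partially evaluated
  acceptance condition of \<open>a\<close> is a tautology iff every attack on \<open>a\<close> contains an \<open>Out\<close> argument
  (evaluate undecided atoms to true), and unsatisfiable iff some attack on \<open>a\<close> is entirely
  \<open>In\<close> (evaluate them to false). This settles conflict-free, admissible and complete. For grounded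
  and preferred one compares minimality or maximality of the \<open>In\<close>-set with the information
  order; both comparisons use that every admissible labelling lies below a least complete one. For
  stable, every acceptance condition of the reduct of a model is a tautology, so the model condition
  alone decides.\<close>

section \<open>Labels, truth values and the relabelling bijection\<close>

fun tv_of :: "label \<Rightarrow> tv" where
  "tv_of In = TT"
| "tv_of Out = FF"
| "tv_of Undec = UU"

lemma tv_of_eq_iff [simp]:
  "tv_of x = TT \<longleftrightarrow> x = In" "tv_of x = FF \<longleftrightarrow> x = Out" "tv_of x = UU \<longleftrightarrow> x = Undec"
  by (cases x; simp)+

lemma bij_tv_of: "bij tv_of"
proof (rule bijI)
  show "inj tv_of"
  proof (rule injI)
    show "tv_of x = tv_of y \<Longrightarrow> x = y" for x y
      by (cases x; cases y) simp_all
  qed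
  have "y \<in> range tv_of" for y
    by (cases y) (metis rangeI tv_of.simps)+
  then show "surj tv_of"
    by blast
qed

definition int_of :: "'a setaf \<Rightarrow> ('a \<Rightarrow> label) \<Rightarrow> 'a \<Rightarrow> tv" where
  "int_of F l = (\<lambda>s \<in> arguments F. tv_of (l s))"

lemma int_of_apply [simp]: "a \<in> arguments F \<Longrightarrow> int_of F l a = tv_of (l a)"
  by (simp add: int_of_def)

lemma statements_setadf_of [simp]: "statements (setadf_of F) = arguments F"
  by (simp add: setadf_of_def)

lemma int_of_interpretation [simp]: "int_of F l \<in> interpretations (setadf_of F)"
  by (simp add: int_of_def interpretations_def)

text \<open>Both sides consist of extensional functions on the same set, so composing pointwise with
  \<open>tv_of\<close> or with its inverse is undone exactly, also outside the arguments. With this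
  bijection on all labellings, each semantics only needs a membership equivalence.\<close>

lemma bij_betw_int_of: "bij_betw (int_of F) (labellings F) (interpretations (setadf_of F))"
proof (rule bij_betw_byWitness[where f' = "\<lambda>v. \<lambda>s \<in> arguments F. inv tv_of (v s)"])
  show "\<forall>l\<in>labellings F. (\<lambda>s\<in>arguments F. inv tv_of (int_of F l s)) = l"
    unfolding labellings_def
    by (intro ballI PiE_ext[of _ "arguments F" "\<lambda>_. UNIV"])
       (simp_all add: bij_tv_of bij_is_inj inv_f_f)
  show "\<forall>v\<in>interpretations (setadf_of F). int_of F (\<lambda>s\<in>arguments F. inv tv_of (v s)) = v"
    unfolding interpretations_def statements_setadf_of
    by (intro ballI PiE_ext[of _ "arguments F" "\<lambda>_. UNIV"])
       (simp_all add: int_of_def bij_tv_of bij_is_surj surj_f_inv_f)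
qed (auto simp: labellings_def)

lemma interpretation_cases:
  assumes "v \<in> interpretations (setadf_of F)"
  obtains l where "l \<in> labellings F" "v = int_of F l"
  using assms bij_betw_int_of[of F] by (auto simp: bij_betw_def)

lemma int_of_eq_iff:
  "l \<in> labellings F \<Longrightarrow> m \<in> labellings F \<Longrightarrow> int_of F l = int_of F m \<longleftrightarrow> l = m"
  using bij_betw_int_of[of F] by (auto simp: bij_betw_def inj_on_eq_iff)

lemma labellings_eqI:
  "l \<in> labellings F \<Longrightarrow> m \<in> labellings F \<Longrightarrow> (\<And>a. a \<in> arguments F \<Longrightarrow> l a = m a) \<Longrightarrow> l = m"
  unfolding labellings_def by (rule PiE_ext)

lemma eval_subst: "eval I (subst f \<phi>) \<longleftrightarrow> eval (\<lambda>p. eval I (f p)) \<phi>"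
  by (induction \<phi>) auto

text \<open>The information order pulled back along \<open>int_of\<close>.\<close>

definition lab_le :: "'a setaf \<Rightarrow> ('a \<Rightarrow> label) \<Rightarrow> ('a \<Rightarrow> label) \<Rightarrow> bool" where
  "lab_le F l m \<longleftrightarrow> (\<forall>a \<in> arguments F. l a \<noteq> Undec \<longrightarrow> m a = l a)"

lemma lab_le_antisym:
  assumes "lab_le F l m" "lab_le F m l" "l \<in> labellings F" "m \<in> labellings F"
  shows "l = m"
  using assms(3,4)
proof (rule labellings_eqI)
  fix a assume "a \<in> arguments F"
  then show "l a = m a"
    using assms(1,2) by (metis lab_le_def)
qed

lemma info_le_int_of [simp]:
  "info_le (setadf_of F) (int_of F l) (int_of F m) \<longleftrightarrow> lab_le F l m"
proof -
  have "tv_le (tv_of x) (tv_of y) \<longleftrightarrow> (x \<noteq> Undec \<longrightarrow> y = x)" for x y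
    by (cases x; cases y) (auto simp: tv_le_def)
  then show ?thesis
    by (simp add: info_le_def lab_le_def)
qed

lemma lab_cf_labelling: "lab_cf F l \<Longrightarrow> l \<in> labellings F"
  by (simp add: lab_cf_def)

lemma lab_adm_labelling: "lab_adm F l \<Longrightarrow> l \<in> labellings F"
  by (simp add: lab_adm_def lab_cf_labelling)

lemma lab_com_labelling: "lab_com F l \<Longrightarrow> l \<in> labellings F"
  by (simp add: lab_com_def lab_cf_labelling)

lemma lab_com_imp_adm: "lab_com F l \<Longrightarrow> lab_adm F l"
  by (simp add: lab_com_def lab_adm_def)

lemma setaf_labellings_subset: "setaf_labellings \<sigma> F \<subseteq> labellings F"
  by (cases \<sigma>) (auto simp: lab_stb_def lab_grd_def lab_prf_def
      lab_cf_labelling lab_adm_labelling lab_com_labelling)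

lemma adf_interpretations_subset: "adf_interpretations \<sigma> D \<subseteq> interpretations D"
  by (cases \<sigma>) (auto simp: int_cf_def int_adm_def int_com_def int_grd_def int_prf_def
      int_stb_def is_model_def)

section \<open>Defence, defeat and the generated labelling\<close>

definition defended :: "'a setaf \<Rightarrow> ('a \<Rightarrow> label) \<Rightarrow> 'a \<Rightarrow> bool" where
  "defended F l a \<longleftrightarrow> (\<forall>B. (B, a) \<in> attacks F \<longrightarrow> (\<exists>b\<in>B. l b = Out))"

definition defeated :: "'a setaf \<Rightarrow> ('a \<Rightarrow> label) \<Rightarrow> 'a \<Rightarrow> bool" where
  "defeated F l a \<longleftrightarrow> (\<exists>B. (B, a) \<in> attacks F \<and> (\<forall>b\<in>B. l b = In))"

text \<open>The least complete labelling above an admissible one is generated by these rules.\<close>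

inductive cl_in cl_out for F :: "'a setaf" and l :: "'a \<Rightarrow> label" where
  base_in: "a \<in> arguments F \<Longrightarrow> l a = In \<Longrightarrow> cl_in F l a"
| step_in: "a \<in> arguments F \<Longrightarrow> (\<And>B. (B, a) \<in> attacks F \<Longrightarrow> \<exists>b\<in>B. cl_out F l b) \<Longrightarrow> cl_in F l a"
| base_out: "a \<in> arguments F \<Longrightarrow> l a = Out \<Longrightarrow> cl_out F l a"
| step_out: "(B, a) \<in> attacks F \<Longrightarrow> (\<And>b. b \<in> B \<Longrightarrow> cl_in F l b) \<Longrightarrow> cl_out F l a"

text \<open>For admissible \<open>l\<close> the order of the two tests is immaterial, because
  \<open>cl_in\<close> and \<open>cl_out\<close> are then disjoint.\<close>

definition closure :: "'a setaf \<Rightarrow> ('a \<Rightarrow> label) \<Rightarrow> 'a \<Rightarrow> label" where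
  "closure F l = (\<lambda>a \<in> arguments F. if cl_in F l a then In else if cl_out F l a then Out else Undec)"

section \<open>Acceptance conditions of the associated SETADF\<close>

locale setaf =
  fixes F :: "'a setaf"
  assumes is_setaf: "is_setaf F"
begin

lemma attacksD:
  assumes "(B, a) \<in> attacks F"
  shows "finite B" "B \<noteq> {}" "a \<in> arguments F" "b \<in> B \<Longrightarrow> b \<in> arguments F"
  using assms is_setaf by (auto simp: is_setaf_def dest: finite_subset)

lemma finite_attackers: "finite {B. (B, a) \<in> attacks F}"
  by (rule finite_subset[of _ "Pow (arguments F)"]) (use is_setaf in \<open>auto simp: is_setaf_def\<close>)

lemma eval_acc:
  "eval I (acc (setadf_of F) a) \<longleftrightarrow> (\<forall>B. (B, a) \<in> attacks F \<longrightarrow> (\<exists>b\<in>B. \<not> I b))"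
  by (auto simp: setadf_of_def eval_Conj eval_Disj finite_attackers attacksD)

lemma eval_pval_acc:
  "eval I (pval v (acc (setadf_of F) a)) \<longleftrightarrow>
     (\<forall>B. (B, a) \<in> attacks F \<longrightarrow> (\<exists>b\<in>B. v b = FF \<or> v b = UU \<and> \<not> I b))"
proof -
  have "\<not> eval I (case x of TT \<Rightarrow> Top | FF \<Rightarrow> Bot | UU \<Rightarrow> Atom b) \<longleftrightarrow> x = FF \<or> x = UU \<and> \<not> I b" for x b
    by (cases x) auto
  then show ?thesis
    by (simp add: pval_def eval_subst eval_acc)
qed

lemma tautology_pval_acc:
  "tautology (pval (int_of F l) (acc (setadf_of F) a)) \<longleftrightarrow> defended F l a"
proof
  assume "tautology (pval (int_of F l) (acc (setadf_of F) a))"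
  then have "eval (\<lambda>_. True) (pval (int_of F l) (acc (setadf_of F) a))"
    by (simp add: tautology_def)
  then show "defended F l a"
    by (fastforce simp: eval_pval_acc defended_def dest: attacksD(4))
next
  assume "defended F l a"
  then have "\<exists>b\<in>B. int_of F l b = FF" if "(B, a) \<in> attacks F" for B
    \<comment> \<open>\<open>int_of\<close> agrees with \<open>tv_of\<close> only on arguments, so
      the members of an attack must be known to be arguments.\<close>
    using that attacksD(4) by (metis defended_def int_of_apply tv_of_eq_iff(2))
  then show "tautology (pval (int_of F l) (acc (setadf_of F) a))"
    by (fastforce simp: tautology_def eval_pval_acc)
qed

lemma unsatisfiable_pval_acc:
  "unsatisfiable (pval (int_of F l) (acc (setadf_of F) a)) \<longleftrightarrow> defeated F l a"
proof
  assume "unsatisfiable (pval (int_of F l) (acc (setadf_of F) a))"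
  then have "\<not> eval (\<lambda>_. False) (pval (int_of F l) (acc (setadf_of F) a))"
    by (simp add: satisfiable_def)
  then obtain B where B: "(B, a) \<in> attacks F" "\<And>b. b \<in> B \<Longrightarrow> int_of F l b \<noteq> FF \<and> int_of F l b \<noteq> UU"
    by (auto simp: eval_pval_acc)
  then have "\<forall>b\<in>B. l b = In"
    by (metis attacksD(4) int_of_apply label.exhaust tv_of_eq_iff(2,3))
  with B(1) show "defeated F l a"
    by (auto simp: defeated_def)
next
  assume "defeated F l a"
  then obtain B where "(B, a) \<in> attacks F" "\<forall>b\<in>B. int_of F l b = TT"
    by (auto simp: defeated_def attacksD(4))
  then show "unsatisfiable (pval (int_of F l) (acc (setadf_of F) a))"
    by (fastforce simp: satisfiable_def eval_pval_acc)
qed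

lemma not_defended_and_defeated: "defended F l a \<Longrightarrow> defeated F l a \<Longrightarrow> False"
  by (fastforce simp: defended_def defeated_def)

section \<open>Conflict-free, admissible and complete, argument by argument\<close>

text \<open>Targets of attacks are arguments, so the clause ranging over attacks can be localised at
  each argument.\<close>

lemma lab_cf_iff:
  "lab_cf F l \<longleftrightarrow> l \<in> labellings F \<and>
     (\<forall>a \<in> arguments F. (l a = In \<longrightarrow> \<not> defeated F l a) \<and> (l a = Out \<longrightarrow> defeated F l a))"
  unfolding lab_cf_def defeated_def using attacksD(3) by blast

text \<open>Defence of an \<open>In\<close> argument already excludes its defeat, so the first
  conflict-freeness clause is absorbed.\<close>

lemma lab_adm_iff:
  "lab_adm F l \<longleftrightarrow> l \<in> labellings F \<and>
     (\<forall>a \<in> arguments F. (l a = In \<longrightarrow> defended F l a) \<and> (l a = Out \<longrightarrow> defeated F l a))"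
  unfolding lab_adm_def lab_cf_iff defended_def[symmetric]
  using not_defended_and_defeated by blast

lemma lab_com_iff:
  "lab_com F l \<longleftrightarrow> l \<in> labellings F \<and>
     (\<forall>a \<in> arguments F. (l a = In \<longleftrightarrow> defended F l a) \<and> (l a = Out \<longleftrightarrow> defeated F l a))"
  unfolding lab_com_def lab_cf_iff defended_def[symmetric] defeated_def[symmetric]
  using not_defended_and_defeated by blast

lemma Gamma_int_of:
  "a \<in> arguments F \<Longrightarrow> Gamma (setadf_of F) (int_of F l) a =
     (if defended F l a then TT else if defeated F l a then FF else UU)"
  by (simp add: Gamma_def tautology_pval_acc unsatisfiable_pval_acc)

lemma int_cf_int_of: "l \<in> labellings F \<Longrightarrow> int_cf (setadf_of F) (int_of F l) \<longleftrightarrow> lab_cf F l"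
  unfolding int_cf_def lab_cf_iff unsatisfiable_pval_acc using unsatisfiable_pval_acc by auto

lemma int_adm_int_of:
  assumes "l \<in> labellings F"
  shows "int_adm (setadf_of F) (int_of F l) \<longleftrightarrow> lab_adm F l"
proof -
  have "tv_le (tv_of (l a)) (Gamma (setadf_of F) (int_of F l) a) \<longleftrightarrow>
      (l a = In \<longrightarrow> defended F l a) \<and> (l a = Out \<longrightarrow> defeated F l a)"
    if "a \<in> arguments F" for a
    \<comment> \<open>\<open>Gamma\<close> tests for a tautology first; exclusivity ensures that a
      defeated argument still receives \<open>FF\<close>.\<close>
    using that not_defended_and_defeated[of l a]
    by (cases "l a") (auto simp: tv_le_def Gamma_int_of)
  then show ?thesis
    using assms by (auto simp: int_adm_def info_le_def lab_adm_iff)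
qed

lemma int_com_int_of:
  assumes "l \<in> labellings F"
  shows "int_com (setadf_of F) (int_of F l) \<longleftrightarrow> lab_com F l"
proof -
  have "Gamma (setadf_of F) (int_of F l) \<in> interpretations (setadf_of F)"
    by (simp add: Gamma_def interpretations_def)
  then have "int_of F l = Gamma (setadf_of F) (int_of F l) \<longleftrightarrow>
      (\<forall>a \<in> arguments F. int_of F l a = Gamma (setadf_of F) (int_of F l) a)"
    using int_of_interpretation[of F l] by (metis PiE_ext interpretations_def statements_setadf_of)
  moreover have "int_of F l a = Gamma (setadf_of F) (int_of F l) a \<longleftrightarrow>
      (l a = In \<longleftrightarrow> defended F l a) \<and> (l a = Out \<longleftrightarrow> defeated F l a)"
    if "a \<in> arguments F" for a
    using that not_defended_and_defeated[of l a]
    by (cases "l a") (auto simp: Gamma_int_of)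
  ultimately show ?thesis
    using assms by (auto simp: int_com_def lab_com_iff)
qed

section \<open>The least complete labelling above an admissible one\<close>

lemma closure_labelling: "closure F l \<in> labellings F"
  by (simp add: closure_def labellings_def)

context
  fixes l assumes adm: "lab_adm F l"
begin

text \<open>Mutual rule induction. An \<open>Out\<close> argument of \<open>l\<close> has an attack
  that is entirely \<open>In\<close>, yet \<open>step_in\<close> would put a derived-out member into
  it, which by induction is not \<open>In\<close>. Dually, an \<open>In\<close> argument has an
  \<open>Out\<close> member in every attack, which by induction cannot be derived in.\<close>

lemma cl_consistent_base:
  "cl_in F l a \<Longrightarrow> l a \<noteq> Out"
  "cl_out F l a \<Longrightarrow> l a \<noteq> In"
proof (induction rule: cl_in_cl_out.inducts)
  case (step_in a)
  show ?case
  proof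
    assume "l a = Out"
    then obtain B where "(B, a) \<in> attacks F" "\<forall>b\<in>B. l b = In"
      using adm step_in by (auto simp: lab_adm_iff defeated_def)
    then show False
      using step_in by blast
  qed
next
  case (step_out B a)
  then show ?case
    using adm attacksD(3)[of B a] by (fastforce simp: lab_adm_iff defended_def)
qed auto

lemma cl_disjoint: "cl_in F l a \<Longrightarrow> \<not> cl_out F l a"
proof -
  \<comment> \<open>The symmetric second claim is added so that the mutual induction supplies a
    hypothesis for both predicates.\<close>
  have "cl_in F l a \<Longrightarrow> \<not> cl_out F l a" "cl_out F l a \<Longrightarrow> \<not> cl_in F l a" for a
  proof (induction rule: cl_in_cl_out.inducts)
    case (step_in a)
    show ?case
    proof
      assume "cl_out F l a"
      then show False
      proof cases
        case base_out
        then show False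
          \<comment> \<open>The rule rederives \<open>cl_in F l a\<close>, which consistency with
            \<open>l\<close> forbids for an argument labelled \<open>Out\<close>.\<close>
          using cl_consistent_base(1) cl_in_cl_out.step_in[of a F l] step_in by blast
      next
        case (step_out B)
        then show False
          using step_in by blast
      qed
    qed
  next
    case (step_out B a)
    show ?case
    proof
      assume "cl_in F l a"
      then show False
      proof cases
        case base_in
        then show False
          using cl_consistent_base(2) cl_in_cl_out.step_out[of B a F l] step_out by blast
      next
        case step_in
        then show False
          using step_out by blast
      qed
    qed
  qed (use cl_consistent_base in blast)+
  then show "cl_in F l a \<Longrightarrow> \<not> cl_out F l a"
    by blast
qed

lemma closure_eq_iff:
  assumes "a \<in> arguments F"
  shows "closure F l a = In \<longleftrightarrow> cl_in F l a" "closure F l a = Out \<longleftrightarrow> cl_out F l a"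
  using assms cl_disjoint by (auto simp: closure_def)

lemma closure_extends: "lab_le F l (closure F l)"
  unfolding lab_le_def
proof (intro ballI impI)
  fix a assume a: "a \<in> arguments F" "l a \<noteq> Undec"
  then show "closure F l a = l a"
    using base_in[of a F l] base_out[of a F l] closure_eq_iff[of a] by (cases "l a") auto
qed

text \<open>Inverting the rules gives the two equivalences of completeness. Only the base rules need
  an argument: by admissibility the labels of \<open>l\<close> are justified by other labels of
  \<open>l\<close>, and these are again derivable by base rules.\<close>

lemma lab_com_closure: "lab_com F (closure F l)"
  unfolding lab_com_iff
proof (intro conjI ballI closure_labelling)
  fix a assume a: "a \<in> arguments F"
  have eq: "(\<exists>b\<in>B. closure F l b = Out) \<longleftrightarrow> (\<exists>b\<in>B. cl_out F l b)"
    "(\<forall>b\<in>B. closure F l b = In) \<longleftrightarrow> (\<forall>b\<in>B. cl_in F l b)" if "(B, a) \<in> attacks F" for B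
    using closure_eq_iff[OF attacksD(4)[OF that]] by blast+
  have "cl_in F l a \<longleftrightarrow> (\<forall>B. (B, a) \<in> attacks F \<longrightarrow> (\<exists>b\<in>B. cl_out F l b))"
  proof
    assume "cl_in F l a"
    then show "\<forall>B. (B, a) \<in> attacks F \<longrightarrow> (\<exists>b\<in>B. cl_out F l b)"
    proof cases
      case base_in
      then have "defended F l a"
        using adm by (simp add: lab_adm_iff)
      then show ?thesis
        by (meson attacksD(4) base_out defended_def)
    qed simp
  next
    assume "\<forall>B. (B, a) \<in> attacks F \<longrightarrow> (\<exists>b\<in>B. cl_out F l b)"
    then show "cl_in F l a"
      by (intro step_in a) simp
  qed
  then show "closure F l a = In \<longleftrightarrow> defended F (closure F l) a"
    using a by (simp add: closure_eq_iff(1) defended_def eq)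
  have "cl_out F l a \<longleftrightarrow> (\<exists>B. (B, a) \<in> attacks F \<and> (\<forall>b\<in>B. cl_in F l b))"
  proof
    assume "cl_out F l a"
    then show "\<exists>B. (B, a) \<in> attacks F \<and> (\<forall>b\<in>B. cl_in F l b)"
    proof cases
      case base_out
      then have "defeated F l a"
        using adm by (simp add: lab_adm_iff)
      then show ?thesis
        by (meson attacksD(4) base_in defeated_def)
    qed auto
  qed (auto intro: step_out)
  then show "closure F l a = Out \<longleftrightarrow> defeated F (closure F l) a"
    using a by (simp add: closure_eq_iff(2) defeated_def eq cong: conj_cong)
qed

text \<open>Rule induction: a complete \<open>m\<close> above \<open>l\<close> satisfies the base
  rules by \<open>lab_le\<close> and the step rules by completeness.\<close>

lemma closure_least:
  assumes "lab_com F m" "lab_le F l m"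
  shows "lab_le F (closure F l) m"
proof -
  have "cl_in F l a \<Longrightarrow> m a = In" "cl_out F l a \<Longrightarrow> m a = Out" for a
  proof (induction rule: cl_in_cl_out.inducts)
    case (step_in a)
    then have "defended F m a"
      by (auto simp: defended_def)
    then show ?case
      using assms(1) step_in(1) by (simp add: lab_com_iff)
  next
    case (step_out B a)
    then have "defeated F m a"
      by (auto simp: defeated_def)
    then show ?case
      using assms(1) attacksD(3)[OF step_out(1)] by (simp add: lab_com_iff)
  qed (use assms(2) in \<open>auto simp: lab_le_def\<close>)
  then show ?thesis
    by (auto simp: lab_le_def closure_def)
qed

end

section \<open>\<open>In\<close>-sets versus the information order: grounded and preferred\<close>

text \<open>An \<open>Out\<close> argument of \<open>l\<close> is defeated by an attack that is
  entirely \<open>In\<close>. That attack stays entirely \<open>In\<close> under the larger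
  \<open>In\<close>-set, and completeness of \<open>m\<close> then forces
  \<open>Out\<close>.\<close>

lemma lab_le_if_In_subset:
  assumes "lab_adm F l" "lab_com F m" "label_set F l In \<subseteq> label_set F m In"
  shows "lab_le F l m"
  unfolding lab_le_def
proof (intro ballI impI)
  fix a assume a: "a \<in> arguments F" "l a \<noteq> Undec"
  have In: "m b = In" if "b \<in> arguments F" "l b = In" for b
    using assms(3) that by (auto simp: label_set_def)
  show "m a = l a"
  proof (cases "l a")
    case Out
    then have "defeated F l a"
      using a assms(1) by (simp add: lab_adm_iff)
    then have "defeated F m a"
      unfolding defeated_def using In attacksD(4) by metis
    then show ?thesis
      using Out a assms(2) by (simp add: lab_com_iff)
  qed (use a In in auto)
qed

lemma lab_le_imp_In_subset: "lab_le F l m \<Longrightarrow> label_set F l In \<subseteq> label_set F m In"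
  by (auto simp: lab_le_def label_set_def)

text \<open>The closure of the all-undecided labelling is the least complete labelling, and a
  complete labelling with minimal \<open>In\<close>-set must coincide with it.\<close>

lemma lab_grd_iff: "lab_grd F l \<longleftrightarrow> lab_com F l \<and> (\<forall>m. lab_com F m \<longrightarrow> lab_le F l m)"
proof
  assume grd: "lab_grd F l"
  then have com: "lab_com F l"
    by (simp add: lab_grd_def)
  \<comment> \<open>The all-undecided labelling is vacuously admissible and lies below every
    labelling.\<close>
  define u where "u = (\<lambda>a\<in>arguments F. Undec)"
  have u: "lab_adm F u" "\<And>m. lab_le F u m"
    by (simp_all add: u_def lab_adm_iff labellings_def lab_le_def)
  have "label_set F (closure F u) In \<subseteq> label_set F l In"
    using closure_least[OF u(1) com u(2)] by (rule lab_le_imp_In_subset)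
  then have "label_set F l In \<subseteq> label_set F (closure F u) In"
    using grd lab_com_closure[OF u(1)] by (auto simp: lab_grd_def)
  then have "lab_le F l (closure F u)"
    using com lab_com_closure[OF u(1)] by (simp add: lab_com_imp_adm lab_le_if_In_subset)
  then have "l = closure F u"
    using closure_least[OF u(1) com u(2)] closure_labelling com
    by (simp add: lab_le_antisym lab_com_labelling)
  then show "lab_com F l \<and> (\<forall>m. lab_com F m \<longrightarrow> lab_le F l m)"
    using com closure_least[OF u(1) _ u(2)] by blast
next
  assume "lab_com F l \<and> (\<forall>m. lab_com F m \<longrightarrow> lab_le F l m)"
  then show "lab_grd F l"
    unfolding lab_grd_def using lab_le_imp_In_subset by blast
qed

text \<open>This replaces \<open>In\<close>-maximality among complete labellings by
  information-maximality among admissible ones. The closure mediates: it turns an admissible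
  labelling above \<open>l\<close> into a complete one without shrinking the
  \<open>In\<close>-set.\<close>

lemma lab_prf_iff:
  "lab_prf F l \<longleftrightarrow> lab_adm F l \<and> \<not> (\<exists>m. lab_adm F m \<and> lab_le F l m \<and> m \<noteq> l)"
proof
  assume pref: "lab_prf F l"
  then have com: "lab_com F l"
    by (simp add: lab_prf_def)
  have "m = l" if m: "lab_adm F m" "lab_le F l m" for m
  proof -
    have "label_set F l In \<subseteq> label_set F m In" "label_set F m In \<subseteq> label_set F (closure F m) In"
      using m closure_extends by (auto intro!: lab_le_imp_In_subset)
    then have "label_set F m In \<subseteq> label_set F l In"
      using pref lab_com_closure[OF m(1)] unfolding lab_prf_def by blast
    then have "lab_le F m l"
      using m(1) com by (simp add: lab_le_if_In_subset)
    then show ?thesis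
      using m com by (auto intro: lab_le_antisym lab_adm_labelling lab_com_labelling)
  qed
  then show "lab_adm F l \<and> \<not> (\<exists>m. lab_adm F m \<and> lab_le F l m \<and> m \<noteq> l)"
    using com lab_com_imp_adm by blast
next
  assume max: "lab_adm F l \<and> \<not> (\<exists>m. lab_adm F m \<and> lab_le F l m \<and> m \<noteq> l)"
  \<comment> \<open>The closure is itself admissible and lies above \<open>l\<close>, so maximality
    of \<open>l\<close> collapses it to \<open>l\<close>.\<close>
  then have "closure F l = l"
    using closure_extends lab_com_closure lab_com_imp_adm by blast
  then have com: "lab_com F l"
    using max lab_com_closure by metis
  moreover have False if "lab_com F m" "label_set F l In \<subset> label_set F m In" for m
    using that max lab_le_if_In_subset[of l m] lab_com_imp_adm[of F m] by blast
  ultimately show "lab_prf F l"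
    by (auto simp: lab_prf_def)
qed

lemma int_grd_int_of:
  assumes "l \<in> labellings F"
  shows "int_grd (setadf_of F) (int_of F l) \<longleftrightarrow> lab_grd F l"
proof -
  have "int_grd (setadf_of F) (int_of F l) \<longleftrightarrow> int_com (setadf_of F) (int_of F l) \<and>
      (\<forall>w. int_com (setadf_of F) w \<longrightarrow> info_le (setadf_of F) (int_of F l) w)"
    by (auto simp: int_grd_def int_com_def)
  also have "\<dots> \<longleftrightarrow> lab_grd F l"
    unfolding lab_grd_iff int_com_int_of[OF assms]
    \<comment> \<open>Every interpretation is the image of a labelling, so the quantifier over
      \<open>w\<close> becomes one over complete labellings.\<close>
    by (metis info_le_int_of int_com_def int_com_int_of interpretation_cases lab_com_labelling)
  finally show ?thesis .
qed

lemma int_prf_int_of: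
  assumes "l \<in> labellings F"
  shows "int_prf (setadf_of F) (int_of F l) \<longleftrightarrow> lab_prf F l"
proof -
  have "(\<exists>w. int_adm (setadf_of F) w \<and> info_le (setadf_of F) (int_of F l) w \<and> w \<noteq> int_of F l) \<longleftrightarrow>
      (\<exists>m. lab_adm F m \<and> lab_le F l m \<and> m \<noteq> l)" (is "?L \<longleftrightarrow> ?R")
  proof
    assume ?L
    then obtain w where w: "int_adm (setadf_of F) w" "info_le (setadf_of F) (int_of F l) w"
      "w \<noteq> int_of F l"
      by blast
    from w(1) have "w \<in> interpretations (setadf_of F)"
      by (simp add: int_adm_def)
    then obtain m where "m \<in> labellings F" "w = int_of F m"
      by (rule interpretation_cases)
    with w show ?R
      by (auto simp: int_adm_int_of)
  next
    assume ?R
    then obtain m where m: "lab_adm F m" "lab_le F l m" "m \<noteq> l"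
      by blast
    from m(1) have "m \<in> labellings F"
      by (rule lab_adm_labelling)
    with m assms show ?L
      by (intro exI[of _ "int_of F m"]) (simp add: int_adm_int_of int_of_eq_iff)
  qed
  then show ?thesis
    by (simp add: int_prf_def lab_prf_iff int_adm_int_of assms)
qed

section \<open>Models and stable interpretations\<close>

lemma is_model_int_of:
  assumes "l \<in> labellings F"
  shows "is_model (setadf_of F) (int_of F l) \<longleftrightarrow> lab_stb F l"
proof (cases "label_set F l Undec = {}")
  case True
  then have two: "l a = In \<or> l a = Out" if "a \<in> arguments F" for a
    using that by (cases "l a") (auto simp: label_set_def)
  have tv: "l b \<noteq> In \<longleftrightarrow> l b = Out" if "b \<in> B" "(B, a) \<in> attacks F" for a b B
    using two[OF attacksD(4)[OF that(2,1)]] by auto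
  \<comment> \<open>Without undecided arguments, not \<open>In\<close> means \<open>Out\<close>, so
    defeat and defence are complementary.\<close>
  have dd: "defeated F l a \<longleftrightarrow> \<not> defended F l a" for a
    unfolding defeated_def defended_def using tv by metis
  \<comment> \<open>By \<open>dd\<close> the partially evaluated condition is either a tautology or
    unsatisfiable, so its value is the same under every assignment.\<close>
  have ev: "eval I (pval (int_of F l) (acc (setadf_of F) a)) \<longleftrightarrow> defended F l a" for I a
    by (metis dd satisfiable_def tautology_def tautology_pval_acc unsatisfiable_pval_acc)
  have "tv_of (l a) = (if defended F l a then TT else FF) \<longleftrightarrow>
      (l a = In \<longrightarrow> \<not> defeated F l a) \<and> (l a = Out \<longrightarrow> defeated F l a)" if "a \<in> arguments F" for a
    using two[OF that] by (auto simp: dd)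
  moreover have "two_valued (setadf_of F) (int_of F l)"
    using True by (auto simp: two_valued_def label_set_def)
  ultimately show ?thesis
    using assms True by (simp add: is_model_def lab_stb_def lab_cf_iff ev)
next
  case False
  then show ?thesis
    by (auto simp: is_model_def lab_stb_def two_valued_def label_set_def)
qed

text \<open>For a model the requirement on the reduct holds automatically: the operator of the
  reduct is constant, with the all-true interpretation as its value.\<close>

lemma int_stb_int_of:
  assumes "l \<in> labellings F"
  shows "int_stb (setadf_of F) (int_of F l) \<longleftrightarrow> lab_stb F l"
proof -
  let ?D = "setadf_of F" and ?v = "int_of F l"
  let ?R = "reduct ?D ?v"
  have "\<exists>w. int_grd ?R w \<and> true_set ?D ?v = true_set ?R w" if model: "is_model ?D ?v"
  proof -
    define w where "w = (\<lambda>a \<in> true_set ?D ?v. TT)"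
    have S: "statements ?R = true_set ?D ?v"
      by (simp add: reduct_def)
    have "tautology (pval u (acc ?R a))" if "a \<in> true_set ?D ?v" for a u
    proof -
      have a: "a \<in> arguments F" "l a = In"
        using that by (auto simp: true_set_def)
      \<comment> \<open>The constantly true assignment rules out the undecided alternative in
        \<open>eval_pval_acc\<close>, which leaves a member valued \<open>FF\<close> in each
        attack.\<close>
      then have "eval (\<lambda>_. True) (pval ?v (acc ?D a))"
        using model by (auto simp: is_model_def split: if_splits)
      then have "\<exists>b\<in>B. ?v b = FF" if "(B, a) \<in> attacks F" for B
        using that by (auto simp: eval_pval_acc)
      then show ?thesis
        \<comment> \<open>The reduct replaces that member by \<open>Bot\<close>, so its negation is
          true whatever \<open>u\<close> and the assignment are.\<close>
        by (fastforce simp: tautology_def pval_def reduct_def eval_subst eval_acc)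
    qed
    then have "Gamma ?R u = w" for u
      by (auto simp: Gamma_def w_def S intro!: restrict_ext)
    moreover have "w \<in> interpretations ?R" "true_set ?R w = true_set ?D ?v"
      by (auto simp: interpretations_def w_def S true_set_def[of ?R])
    ultimately show ?thesis
      \<comment> \<open>A constant operator has its value \<open>w\<close> as its only fixed point,
        which is therefore the least one.\<close>
      by (auto simp: int_grd_def info_le_def tv_le_def)
  qed
  then show ?thesis
    using is_model_int_of[OF assms] by (auto simp: int_stb_def)
qed

section \<open>Assembling the correspondence for all semantics\<close>

lemma int_of_mem_iff:
  assumes "l \<in> labellings F"
  shows "int_of F l \<in> adf_interpretations \<sigma> (setadf_of F) \<longleftrightarrow> l \<in> setaf_labellings \<sigma> F"
  using assms by (cases \<sigma>) (simp_all add: int_cf_int_of int_adm_int_of int_com_int_of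
      int_prf_int_of int_grd_int_of int_stb_int_of)

lemma bij_betw_int_of_semantics:
  "bij_betw (int_of F) (setaf_labellings \<sigma> F) (adf_interpretations \<sigma> (setadf_of F))"
\<comment> \<open>Injectivity is inherited from the bijection on all labellings, so only the image
  has to be computed.\<close>
proof (rule bij_betw_subset[OF bij_betw_int_of setaf_labellings_subset])
  show "int_of F ` setaf_labellings \<sigma> F = adf_interpretations \<sigma> (setadf_of F)"
  proof (intro equalityI subsetI)
    fix v assume v: "v \<in> adf_interpretations \<sigma> (setadf_of F)"
    then have "v \<in> interpretations (setadf_of F)"
      using adf_interpretations_subset by (rule rev_subsetD)
    then obtain l where "l \<in> labellings F" "v = int_of F l"
      by (rule interpretation_cases)
    then show "v \<in> int_of F ` setaf_labellings \<sigma> F"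
      using v by (simp add: int_of_mem_iff)
  next
    fix v assume "v \<in> int_of F ` setaf_labellings \<sigma> F"
    then obtain l where l: "l \<in> setaf_labellings \<sigma> F" "v = int_of F l"
      by (rule imageE)
    moreover from l(1) have "l \<in> labellings F"
      using setaf_labellings_subset by (rule rev_subsetD)
    ultimately show "v \<in> adf_interpretations \<sigma> (setadf_of F)"
      by (simp add: int_of_mem_iff)
  qed
qed

end

theorem theorem2:
  fixes \<sigma> :: semantics and F :: "'a setaf" and D :: "'a adf"
  assumes "is_setaf F"
    and "D = setadf_of F"
  shows "\<exists>f. bij_betw f (setaf_labellings \<sigma> F) (adf_interpretations \<sigma> D) \<and>
           (\<forall>l \<in> setaf_labellings \<sigma> F. \<forall>s \<in> arguments F.
              (f l s = TT \<longleftrightarrow> l s = In) \<and>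
              (f l s = FF \<longleftrightarrow> l s = Out) \<and>
              (f l s = UU \<longleftrightarrow> l s = Undec))"
proof -
  interpret setaf F
    by unfold_locales (fact assms(1))
  have "int_of F l s = tv_of (l s)" if "s \<in> arguments F" for l s
    using that by simp
  then show ?thesis
    unfolding assms(2) by (intro exI[of _ "int_of F"] conjI bij_betw_int_of_semantics) simp
qed

end
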